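(* Let $A,B\in\mathbf{Gr}^{\bullet}$. Every triple of derived actions of $B$ on $A$ in $\mathbf{Gr}^{\bullet}$, written $b\cdot a$, $a^{b}$, $b^{a}$, satisfies the following conditions. (a) For all $a,a_1,a_2\in A$ and $b,b_1,b_2\in B$: $b\cdot(a_1+a_2)=b\cdot a_1+b\cdot a_2$, $(b_1+b_2)\cdot a=b_1\cdot(b_2\cdot a)$, $0_B\cdot a=a$. (b) For all $a\in A$, $b\in B$: $(0_A)^{b}=0_A$, $(0_B)^{a}=0_A$, $b^{0_A}=0_A$, $a^{0_B}=a$; and for all $a,a'\in A$, $b,b'\in B$: $(1_A)$ $(a+a')^{b}=a^{b}+(a')^{b}$, $(2_A)$ $(b+b')^{a}=b^{a}+b\cdot\left((b')^{a}\right)$, $(3_A)$ $(b\cdot a)^{a'}+b^{a'}=b^{a'}+b\cdot\left(a^{a'}\right)$, $(4_A)$ $(b\cdot a)^{b'}=b^{b'}\cdot a^{b'}$, $(1_B)$ $b^{(a+a')}=\left(b^{a}\right)^{a'}+b^{a'}$, $(2_B)$ $a^{b+b'}=\left(a^{b}\right)^{b'}$, $(3_B)$ $\left(a^{(b\cdot a')}\right)^{b}=\left(a^{b}\right)^{a'}$, $(4_B)$ $\left(b^{(b'\cdot a)}\right)^{b'}=\left(b^{b'}\right)^{a}$.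
   Context: Groups are written additively but need not be commutative. An object of the category $\mathbf{Gr}^{\bullet}$ (groups with action on itself) is a group $G$ with a map $G\times G\to G$, $(g,h)\mapsto g^{h}$, such that $g^{g'+g''}=(g^{g'})^{g''}$, $g^{0}=g$ and $(g'+g'')^{g}=g'^{g}+g''^{g}$ for all $g,g',g''\in G$. Morphisms are group homomorphisms $\varphi$ with $\varphi(g^{h})=\varphi(g)^{\varphi(h)}$. For $A,B\in\mathbf{Gr}^{\bullet}$, a triple of actions of $B$ on $A$ is a triple of maps $B\times A\to A$, written $(b,a)\mapsto b\cdot a$, $(b,a)\mapsto a^{b}$, $(b,a)\mapsto b^{a}$; all three values lie in $A$ (so for $a\in A$, $b\in B$ both $a^b$ and $b^a$ are elements of $A$, while $a^{a'}\in A$ and $b^{b'}\in B$ denote the given actions in $A$ and in $B$). $0_A,0_B$ are the zero elements of $A$ and $B$. A split extension of $B$ by $A$ in $\mathbf{Gr}^{\bullet}$ is a sequence $0\to A\xrightarrow{i}E\xrightarrow{p}B\to 0$ in $\mathbf{Gr}^{\bullet}$ with $p$ surjective, $i$ the kernel of $p$, together with a morphism $j\colon B\to E$ with $pj=1_B$. Identifying $i(a)$ with $a$, it induces a triple of actions of $B$ on $A$ by $$b\cdot a=j(b)+a-j(b),\qquad b^{a}=j(b)^{a}-j(b),\qquad a^{b}=a^{j(b)}.$$ A triple of actions is called a triple of derived actions (in $\mathbf{Gr}^{\bullet}$) if it is induced in this way by some split extension of $B$ by $A$ in $\mathbf{Gr}^{\bullet}$. *)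

theory Defs
  imports "HOL-Algebra.Algebra"
begin

text \<open>
  Groups with action on themselves. The mathematics is written additively for possibly
  non-commutative groups; here the (multiplicative) notation of \<^locale>\<open>group\<close> is used, so
  \<open>g + h\<close>, \<open>0\<close>, \<open>- g\<close> become \<open>g \<otimes> h\<close>, \<open>\<one>\<close>, \<open>inv g\<close>, and the self-action \<open>g\<^sup>h\<close>
  is \<open>g \<triangleleft> h\<close>.
\<close>

record 'a gr_struct = "'a monoid" +
  act :: "'a \<Rightarrow> 'a \<Rightarrow> 'a"  (infixl "\<triangleleft>\<index>" 75)

locale gr_bullet = group G for G :: "'a gr_struct" (structure) +
  assumes act_closed: "\<lbrakk>g \<in> carrier G; h \<in> carrier G\<rbrakk> \<Longrightarrow> g \<triangleleft> h \<in> carrier G"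
    and act_mult: "\<lbrakk>g \<in> carrier G; g' \<in> carrier G; g'' \<in> carrier G\<rbrakk>
      \<Longrightarrow> g \<triangleleft> (g' \<otimes> g'') = (g \<triangleleft> g') \<triangleleft> g''"
    and act_one: "g \<in> carrier G \<Longrightarrow> g \<triangleleft> \<one> = g"
    and mult_act: "\<lbrakk>g \<in> carrier G; g' \<in> carrier G; g'' \<in> carrier G\<rbrakk>
      \<Longrightarrow> (g' \<otimes> g'') \<triangleleft> g = (g' \<triangleleft> g) \<otimes> (g'' \<triangleleft> g)"

definition gr_hom :: "'a gr_struct \<Rightarrow> 'b gr_struct \<Rightarrow> ('a \<Rightarrow> 'b) set" where
  "gr_hom G H = {f \<in> hom G H. \<forall>g\<in>carrier G. \<forall>h\<in>carrier G.
     f (g \<triangleleft>\<^bsub>G\<^esub> h) = f g \<triangleleft>\<^bsub>H\<^esub> f h}"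

text \<open>
  The kernel of \<open>p\<close> in this category is carried by the set \<^term>\<open>kernel E B p\<close>, which is closed
  under the self-action; so \<open>i\<close> is a kernel of \<open>p\<close> iff it is an injective morphism with this image.
\<close>

definition split_extension ::
  "'a gr_struct \<Rightarrow> 'e gr_struct \<Rightarrow> 'b gr_struct \<Rightarrow> ('a \<Rightarrow> 'e) \<Rightarrow> ('e \<Rightarrow> 'b) \<Rightarrow> ('b \<Rightarrow> 'e) \<Rightarrow> bool"
where
  "split_extension A E B i p j \<longleftrightarrow>
     gr_bullet A \<and> gr_bullet E \<and> gr_bullet B \<and>
     i \<in> gr_hom A E \<and> p \<in> gr_hom E B \<and> j \<in> gr_hom B E \<and>
     p ` carrier E = carrier B \<and>
     inj_on i (carrier A) \<and> i ` carrier A = kernel E B p \<and>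
     (\<forall>b\<in>carrier B. p (j b) = b)"

text \<open>
  A triple of actions of \<open>B\<close> on \<open>A\<close> consists of \<open>dot b a\<close> for \<open>b \<cdot> a\<close>, \<open>ab a b\<close> for
  \<open>a\<^sup>b\<close>, and \<open>ba b a\<close> for \<open>b\<^sup>a\<close>, all with values in \<open>A\<close>.
\<close>

definition action_triple ::
  "'a gr_struct \<Rightarrow> 'b gr_struct \<Rightarrow> ('b \<Rightarrow> 'a \<Rightarrow> 'a) \<Rightarrow> ('a \<Rightarrow> 'b \<Rightarrow> 'a) \<Rightarrow> ('b \<Rightarrow> 'a \<Rightarrow> 'a) \<Rightarrow> bool"
where
  "action_triple A B dot ab ba \<longleftrightarrow>
     (\<forall>a\<in>carrier A. \<forall>b\<in>carrier B.
        dot b a \<in> carrier A \<and> ab a b \<in> carrier A \<and> ba b a \<in> carrier A)"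

definition induced_actions ::
  "'a gr_struct \<Rightarrow> 'e gr_struct \<Rightarrow> 'b gr_struct \<Rightarrow> ('a \<Rightarrow> 'e) \<Rightarrow> ('b \<Rightarrow> 'e) \<Rightarrow>
   ('b \<Rightarrow> 'a \<Rightarrow> 'a) \<Rightarrow> ('a \<Rightarrow> 'b \<Rightarrow> 'a) \<Rightarrow> ('b \<Rightarrow> 'a \<Rightarrow> 'a) \<Rightarrow> bool"
where
  "induced_actions A E B i j dot ab ba \<longleftrightarrow>
     (\<forall>a\<in>carrier A. \<forall>b\<in>carrier B.
        i (dot b a) = j b \<otimes>\<^bsub>E\<^esub> i a \<otimes>\<^bsub>E\<^esub> inv\<^bsub>E\<^esub> (j b) \<and>
        i (ba b a) = (j b \<triangleleft>\<^bsub>E\<^esub> i a) \<otimes>\<^bsub>E\<^esub> inv\<^bsub>E\<^esub> (j b) \<and>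
        i (ab a b) = i a \<triangleleft>\<^bsub>E\<^esub> j b)"

text \<open>
  HOL cannot quantify existentially over the type carrying \<open>E\<close>. That type \<open>'e\<close> is a parameter;
  results about all derived actions are stated for arbitrary \<open>'e\<close>.
\<close>

definition derived_actions ::
  "'e itself \<Rightarrow> 'a gr_struct \<Rightarrow> 'b gr_struct \<Rightarrow>
   ('b \<Rightarrow> 'a \<Rightarrow> 'a) \<Rightarrow> ('a \<Rightarrow> 'b \<Rightarrow> 'a) \<Rightarrow> ('b \<Rightarrow> 'a \<Rightarrow> 'a) \<Rightarrow> bool"
where
  "derived_actions _ A B dot ab ba \<longleftrightarrow>
     action_triple A B dot ab ba \<and>
     (\<exists>(E :: 'e gr_struct) i p j.
        split_extension A E B i p j \<and> induced_actions A E B i j dot ab ba)"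

end

theory Submission
  imports Defs
begin

text \<open>
  The statement is about equations that already hold in a single group with action on itself.
  Seen inside \<open>E\<close>, with \<open>A\<close> and \<open>B\<close> embedded by \<open>i\<close> and \<open>j\<close>, the three actions are restrictions
  of operations defined on the whole of \<open>E\<close>: conjugation \<open>x y x\<^sup>-\<^sup>1\<close>, the self-action \<open>x \<triangleleft> y\<close>, and
  \<open>(x \<triangleleft> y) x\<^sup>-\<^sup>1\<close>, the factor by which \<open>y\<close> displaces \<open>x\<close>. Since \<open>i\<close> is injective, each condition
  need only be checked after applying \<open>i\<close>, and it then becomes an instance of an identity that
  holds for arbitrary elements of \<open>E\<close>.

  These identities have two sources. The endomorphism property of \<open>x \<mapsto> x \<triangleleft> y\<close> gives the
  conditions in which an action is applied to a product or to a conjugate. The right action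
  property of \<open>y \<mapsto> (_ \<triangleleft> y)\<close> gives those in which one acts by a product. In particular, one has
  \<open>x y x\<^sup>-\<^sup>1 \<otimes> x = x \<otimes> y\<close>, so acting by a conjugate \<open>x y x\<^sup>-\<^sup>1\<close> and then by \<open>x\<close> amounts to acting
  by \<open>x\<close> and then by \<open>y\<close>; this is the content of the two conditions that mix \<open>\<cdot>\<close> in an exponent
  with a further exponent.
\<close>

context gr_bullet
begin

definition conjugate :: "'a \<Rightarrow> 'a \<Rightarrow> 'a" where
  "conjugate x y = x \<otimes> y \<otimes> inv x"

definition displacement :: "'a \<Rightarrow> 'a \<Rightarrow> 'a" where
  "displacement x y = (x \<triangleleft> y) \<otimes> inv x"

lemma conjugate_closed [simp]:
  "\<lbrakk>x \<in> carrier G; y \<in> carrier G\<rbrakk> \<Longrightarrow> conjugate x y \<in> carrier G"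
  by (simp add: conjugate_def)

lemma displacement_closed [simp]:
  "\<lbrakk>x \<in> carrier G; y \<in> carrier G\<rbrakk> \<Longrightarrow> displacement x y \<in> carrier G"
  by (simp add: displacement_def act_closed)

lemma cancel_inv_left:
  "\<lbrakk>x \<in> carrier G; y \<in> carrier G\<rbrakk> \<Longrightarrow> inv x \<otimes> (x \<otimes> y) = y"
  by (simp add: m_assoc [symmetric])

lemma one_act:
  assumes "x \<in> carrier G"
  shows "\<one> \<triangleleft> x = \<one>"
proof -
  have "(\<one> \<triangleleft> x) \<otimes> (\<one> \<triangleleft> x) = \<one> \<triangleleft> x"
    using mult_act [of x \<one> \<one>] assms by simp
  then show ?thesis
    using assms by (simp add: act_closed)
qed

lemma inv_act:
  assumes "x \<in> carrier G" "y \<in> carrier G"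
  shows "inv x \<triangleleft> y = inv (x \<triangleleft> y)"
proof -
  have "(inv x \<triangleleft> y) \<otimes> (x \<triangleleft> y) = \<one>"
    using assms by (simp add: mult_act [symmetric] one_act)
  then show ?thesis
    using assms by (simp add: inv_equality act_closed)
qed

lemma conjugate_mult:
  assumes "x \<in> carrier G" "y \<in> carrier G" "z \<in> carrier G"
  shows "conjugate x (y \<otimes> z) = conjugate x y \<otimes> conjugate x z"
  using assms by (simp add: conjugate_def m_assoc cancel_inv_left)

lemma mult_conjugate:
  assumes "x \<in> carrier G" "y \<in> carrier G" "z \<in> carrier G"
  shows "conjugate (x \<otimes> y) z = conjugate x (conjugate y z)"
  using assms by (simp add: conjugate_def m_assoc inv_mult_group)

lemma one_conjugate: "x \<in> carrier G \<Longrightarrow> conjugate \<one> x = x"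
  by (simp add: conjugate_def)

lemma conjugate_act:
  assumes "x \<in> carrier G" "y \<in> carrier G" "z \<in> carrier G"
  shows "conjugate x y \<triangleleft> z = conjugate (x \<triangleleft> z) (y \<triangleleft> z)"
  using assms by (simp add: conjugate_def mult_act inv_act)

lemma one_displacement: "x \<in> carrier G \<Longrightarrow> displacement \<one> x = \<one>"
  by (simp add: displacement_def one_act)

lemma displacement_one: "x \<in> carrier G \<Longrightarrow> displacement x \<one> = \<one>"
  by (simp add: displacement_def act_one)

text \<open>
  For any endomorphism \<open>f\<close> of a group, \<open>x \<mapsto> f x \<otimes> inv x\<close> is a crossed homomorphism with
  respect to conjugation; here \<open>f\<close> is \<open>x \<mapsto> x \<triangleleft> z\<close>.
\<close>

lemma mult_displacement:
  assumes "x \<in> carrier G" "y \<in> carrier G" "z \<in> carrier G"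
  shows "displacement (x \<otimes> y) z = displacement x z \<otimes> conjugate x (displacement y z)"
  using assms
  by (simp add: displacement_def conjugate_def mult_act m_assoc inv_mult_group act_closed
      cancel_inv_left)

text \<open>
  Acting on \<open>x\<close> by \<open>y\<close> yields \<open>displacement x y \<otimes> x\<close>, and \<open>z\<close> then acts on this product factor
  by factor.
\<close>

lemma displacement_mult:
  assumes "x \<in> carrier G" "y \<in> carrier G" "z \<in> carrier G"
  shows "displacement x (y \<otimes> z) = (displacement x y \<triangleleft> z) \<otimes> displacement x z"
  using assms
  by (simp add: displacement_def act_mult mult_act inv_act m_assoc act_closed cancel_inv_left)

text \<open>
  The element \<open>x \<triangleleft> z\<close> is \<open>displacement x z \<otimes> x\<close>, so conjugating by it is conjugating by \<open>x\<close>
  and then by the displacement.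
\<close>

lemma conjugate_act_displacement:
  assumes "x \<in> carrier G" "y \<in> carrier G" "z \<in> carrier G"
  shows "conjugate (x \<triangleleft> z) y \<otimes> displacement x z = displacement x z \<otimes> conjugate x y"
  using assms
  by (simp add: displacement_def conjugate_def m_assoc act_closed cancel_inv_left)

text \<open>
  Moving a conjugating element past the action: \<open>conjugate x z \<otimes> x\<close> and \<open>x \<otimes> z\<close> are equal,
  hence act in the same way.
\<close>

lemma act_conjugate_act:
  assumes "x \<in> carrier G" "y \<in> carrier G" "z \<in> carrier G"
  shows "(y \<triangleleft> conjugate x z) \<triangleleft> x = (y \<triangleleft> x) \<triangleleft> z"
proof -
  have "conjugate x z \<otimes> x = x \<otimes> z"
    using assms by (simp add: conjugate_def m_assoc)
  then show ?thesis
    using assms by (metis act_mult conjugate_closed)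
qed

lemma displacement_conjugate_act:
  assumes "x \<in> carrier G" "y \<in> carrier G" "z \<in> carrier G"
  shows "displacement y (conjugate x z) \<triangleleft> x = displacement (y \<triangleleft> x) z"
  using assms by (simp add: displacement_def mult_act inv_act act_closed act_conjugate_act)

end

theorem proposition3p1:
  fixes A :: "'a gr_struct" and B :: "'b gr_struct"
    and dot :: "'b \<Rightarrow> 'a \<Rightarrow> 'a"  (infixr "\<cdot>" 80)
    and ab :: "'a \<Rightarrow> 'b \<Rightarrow> 'a"  (infixl "\<up>" 80)
    and ba :: "'b \<Rightarrow> 'a \<Rightarrow> 'a"  (infixl "\<Up>" 80)
  assumes A: "gr_bullet A" and B: "gr_bullet B"
    and derived: "derived_actions TYPE('e) A B dot ab ba"
  shows
    "(\<forall>a\<in>carrier A. \<forall>a1\<in>carrier A. \<forall>a2\<in>carrier A.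
      \<forall>b\<in>carrier B. \<forall>b1\<in>carrier B. \<forall>b2\<in>carrier B.
        b \<cdot> (a1 \<otimes>\<^bsub>A\<^esub> a2) = (b \<cdot> a1) \<otimes>\<^bsub>A\<^esub> (b \<cdot> a2) \<and>
        (b1 \<otimes>\<^bsub>B\<^esub> b2) \<cdot> a = b1 \<cdot> (b2 \<cdot> a) \<and>
        \<one>\<^bsub>B\<^esub> \<cdot> a = a) \<and>
     (\<forall>a\<in>carrier A. \<forall>b\<in>carrier B.
        \<one>\<^bsub>A\<^esub> \<up> b = \<one>\<^bsub>A\<^esub> \<and>
        \<one>\<^bsub>B\<^esub> \<Up> a = \<one>\<^bsub>A\<^esub> \<and>
        b \<Up> \<one>\<^bsub>A\<^esub> = \<one>\<^bsub>A\<^esub> \<and>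
        a \<up> \<one>\<^bsub>B\<^esub> = a) \<and>
     (\<forall>a\<in>carrier A. \<forall>a'\<in>carrier A. \<forall>b\<in>carrier B. \<forall>b'\<in>carrier B.
        (a \<otimes>\<^bsub>A\<^esub> a') \<up> b = (a \<up> b) \<otimes>\<^bsub>A\<^esub> (a' \<up> b) \<and>
        (b \<otimes>\<^bsub>B\<^esub> b') \<Up> a = (b \<Up> a) \<otimes>\<^bsub>A\<^esub> (b \<cdot> (b' \<Up> a)) \<and>
        ((b \<cdot> a) \<triangleleft>\<^bsub>A\<^esub> a') \<otimes>\<^bsub>A\<^esub> (b \<Up> a') = (b \<Up> a') \<otimes>\<^bsub>A\<^esub> (b \<cdot> (a \<triangleleft>\<^bsub>A\<^esub> a')) \<and>
        (b \<cdot> a) \<up> b' = (b \<triangleleft>\<^bsub>B\<^esub> b') \<cdot> (a \<up> b') \<and>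
        b \<Up> (a \<otimes>\<^bsub>A\<^esub> a') = ((b \<Up> a) \<triangleleft>\<^bsub>A\<^esub> a') \<otimes>\<^bsub>A\<^esub> (b \<Up> a') \<and>
        a \<up> (b \<otimes>\<^bsub>B\<^esub> b') = (a \<up> b) \<up> b' \<and>
        (a \<triangleleft>\<^bsub>A\<^esub> (b \<cdot> a')) \<up> b = (a \<up> b) \<triangleleft>\<^bsub>A\<^esub> a' \<and>
        (b \<Up> (b' \<cdot> a)) \<up> b' = (b \<triangleleft>\<^bsub>B\<^esub> b') \<Up> a)"
proof -
  obtain E :: "'e gr_struct" and i p j
    where ext: "split_extension A E B i p j" and ind: "induced_actions A E B i j dot ab ba"
    using derived by (auto simp: derived_actions_def)
  interpret A: gr_bullet A by (rule A)
  interpret B: gr_bullet B by (rule B)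
  interpret E: gr_bullet E using ext by (simp add: split_extension_def)

  have i: "i \<in> gr_hom A E" and j: "j \<in> gr_hom B E" and inj: "inj_on i (carrier A)"
    using ext by (simp_all add: split_extension_def)
  interpret i: group_hom A E i
    using i by unfold_locales (simp add: gr_hom_def)
  interpret j: group_hom B E j
    using j by unfold_locales (simp add: gr_hom_def)

  have closed: "b \<cdot> a \<in> carrier A" "a \<up> b \<in> carrier A" "b \<Up> a \<in> carrier A"
    if "a \<in> carrier A" "b \<in> carrier B" for a b
    using derived that by (simp_all add: derived_actions_def action_triple_def)

  have i_act: "i (a \<triangleleft>\<^bsub>A\<^esub> a') = i a \<triangleleft>\<^bsub>E\<^esub> i a'"
    if "a \<in> carrier A" "a' \<in> carrier A" for a a'
    using i that by (simp add: gr_hom_def)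
  have j_act: "j (b \<triangleleft>\<^bsub>B\<^esub> b') = j b \<triangleleft>\<^bsub>E\<^esub> j b'"
    if "b \<in> carrier B" "b' \<in> carrier B" for b b'
    using j that by (simp add: gr_hom_def)
  have induced: "i (b \<cdot> a) = E.conjugate (j b) (i a)" "i (b \<Up> a) = E.displacement (j b) (i a)"
    "i (a \<up> b) = i a \<triangleleft>\<^bsub>E\<^esub> j b"
    if "a \<in> carrier A" "b \<in> carrier B" for a b
    using ind that by (simp_all add: induced_actions_def E.conjugate_def E.displacement_def)

  (* Rewriting with these facts turns an equation in A into one in E between values of i and j. *)
  note eqI = inj_onD [OF inj]
  note transport = induced i_act j_act closed A.act_closed B.act_closed E.act_closed

  show ?thesis
    by (intro conjI ballI; rule eqI)
      (simp_all add: transport E.conjugate_mult E.mult_conjugate E.one_conjugate E.conjugate_act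
        E.one_act E.act_one E.mult_act E.act_mult E.one_displacement E.displacement_one
        E.mult_displacement E.displacement_mult E.conjugate_act_displacement
        E.act_conjugate_act E.displacement_conjugate_act)
qed

end
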